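(* Let $q$ be a prime power, $e\ge2$ and $k\ge2$ integers, and $n=3^ek$. For $i=1,\dots,e$ put $K_i=3^{i-1}k$, fix a primitive element $\omega_i$ of $\mathbb{F}_{q^{K_i}}$ and $\gamma_i\in\mathbb{F}_{q^{3K_i}}$ with $\mathbb{F}_{q^{K_i}}(\gamma_i)=\mathbb{F}_{q^{3K_i}}$, and for $a\in\mathbb{F}_{q^{K_i}}$, $j\in\{0,\dots,q-2\}$ define $\Phi_{i,a,j}:\mathbb{F}_{q^{K_i}}\to\mathbb{F}_{q^{3K_i}}$, $\Phi_{i,a,j}(u)=u+\omega_i^j(u^q+au)\gamma_i$. Let $\mathcal{D}_1=\bigcup_{a,j}\mathrm{Orb}_{\mathbb{F}_{q^{3k}}^*}(\Phi_{1,a,j}(\mathbb{F}_{q^k}))\subseteq\mathcal{G}_q(3k,k)$ and, for $i=2,\dots,e$, $\mathcal{D}_i=\{\beta\,\Phi_{i,a,j}(U):\beta\in\mathbb{F}_{q^{3K_i}}^*,\ a\in\mathbb{F}_{q^{K_i}},\ 0\le j\le q-2,\ U\in\mathcal{D}_{i-1}\}\subseteq\mathcal{G}_q(3^ik,k)$, and let ${}_{3^e}\mathcal{C}_k=\mathcal{D}_e$ (a cyclic subspace code in $\mathcal{G}_q(n,k)$ with minimum distance $2k-2$). Then $$\lim_{k\to\infty}\frac{|{}_{3^e}\mathcal{C}_k|}{J_q(3^ek,2k-2,k)}=1\quad(q\text{ fixed}),\qquad\lim_{q\to\infty}\frac{|{}_{3^e}\mathcal{C}_k|}{J_q(3^ek,2k-2,k)}=1\quad(k\text{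 fixed}),$$ i.e. the family is asymptotically optimal in $k$ and in $q$.
   Context: $\mathcal{G}_q(N,k)$ is the set of $k$-dimensional $\mathbb{F}_q$-subspaces of $\mathbb{F}_{q^N}$; $\mathrm{Orb}_{\mathbb{F}_{q^N}^*}(V)=\{\beta V:\beta\in\mathbb{F}_{q^N}^*\}$. The Johnson type bound II quantity for minimum distance $2k-2$ is $J_q(n,2k-2,k)=\left\lfloor\frac{q^n-1}{q^k-1}\left\lfloor\frac{q^{n-1}-1}{q^{k-1}-1}\right\rfloor\right\rfloor$, an upper bound on the size of any subspace code in $\mathcal{G}_q(n,k)$ with minimum subspace distance $2k-2$ (subspace distance $d(U,V)=\dim(U+V)-\dim(U\cap V)$). $|\cdot|$ denotes cardinality of a code as a set of subspaces. *)

theory Defs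
  imports Complex_Main "HOL-Algebra.Generated_Fields" "HOL-Number_Theory.Prime_Powers"
begin

text \<open>All fields are realised inside one ambient finite field R of order q^n.
  The subfield F_{q^m} of R is the set of roots of x^(q^m) = x.\<close>

definition subfld :: "('a, 'b) ring_scheme \<Rightarrow> nat \<Rightarrow> nat \<Rightarrow> 'a set" where
  "subfld R q m = {x \<in> carrier R. x [^]\<^bsub>R\<^esub> (q ^ m) = x}"

definition primitive_elem :: "('a, 'b) ring_scheme \<Rightarrow> nat \<Rightarrow> nat \<Rightarrow> 'a \<Rightarrow> bool" where
  "primitive_elem R q m w \<longleftrightarrow> w \<in> subfld R q m \<and>
     (\<lambda>j::nat. w [^]\<^bsub>R\<^esub> j) ` {..<q ^ m - 1} = subfld R q m - {\<zero>\<^bsub>R\<^esub>}"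

definition Kidx :: "nat \<Rightarrow> nat \<Rightarrow> nat" where
  "Kidx k i = 3 ^ (i - 1) * k"

definition Phi :: "('a, 'b) ring_scheme \<Rightarrow> nat \<Rightarrow> 'a \<Rightarrow> 'a \<Rightarrow> 'a \<Rightarrow> nat \<Rightarrow> 'a \<Rightarrow> 'a" where
  "Phi R q w g a j u = u \<oplus>\<^bsub>R\<^esub> ((w [^]\<^bsub>R\<^esub> j) \<otimes>\<^bsub>R\<^esub> ((u [^]\<^bsub>R\<^esub> q) \<oplus>\<^bsub>R\<^esub> (a \<otimes>\<^bsub>R\<^esub> u)) \<otimes>\<^bsub>R\<^esub> g)"

text \<open>The codes D_i; D_0 = {F_{q^k}}, so D_1 is the union of the orbits of
  Phi_{1,a,j}(F_{q^k}) under F_{q^{3k}}^*, and D_i for i \<ge> 2 as in the paper.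
  w i and g i are the chosen omega_i and gamma_i.\<close>
fun Dcode :: "('a, 'b) ring_scheme \<Rightarrow> nat \<Rightarrow> nat \<Rightarrow> (nat \<Rightarrow> 'a) \<Rightarrow> (nat \<Rightarrow> 'a) \<Rightarrow> nat \<Rightarrow> 'a set set" where
  "Dcode R q k w g 0 = {subfld R q k}"
| "Dcode R q k w g (Suc i) =
     {(\<lambda>x. \<beta> \<otimes>\<^bsub>R\<^esub> x) ` (Phi R q (w (Suc i)) (g (Suc i)) a j ` U) | \<beta> a j U.
        \<beta> \<in> subfld R q (3 * Kidx k (Suc i)) - {\<zero>\<^bsub>R\<^esub>} \<and>
        a \<in> subfld R q (Kidx k (Suc i)) \<and> j \<le> q - 2 \<and> U \<in> Dcode R q k w g i}"

definition cyc_setup :: "('a, 'b) ring_scheme \<Rightarrow> nat \<Rightarrow> nat \<Rightarrow> nat \<Rightarrow> (nat \<Rightarrow> 'a) \<Rightarrow> (nat \<Rightarrow> 'a) \<Rightarrow> bool" where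
  "cyc_setup R q e k w g \<longleftrightarrow> field R \<and> finite (carrier R) \<and> card (carrier R) = q ^ (3 ^ e * k) \<and>
     (\<forall>i \<in> {1..e}. primitive_elem R q (Kidx k i) (w i) \<and>
        g i \<in> subfld R q (3 * Kidx k i) \<and>
        generate_field R (insert (g i) (subfld R q (Kidx k i))) = subfld R q (3 * Kidx k i))"

text \<open>Johnson type bound II for distance 2k-2:
  floor((q^n-1)/(q^k-1) * floor((q^(n-1)-1)/(q^(k-1)-1))).\<close>
definition Jbound :: "nat \<Rightarrow> nat \<Rightarrow> nat \<Rightarrow> nat" where
  "Jbound q n k = ((q ^ n - 1) * ((q ^ (n - 1) - 1) div (q ^ (k - 1) - 1))) div (q ^ k - 1)"

end

theory Submission
  imports Defs "HOL-Number_Theory.Cong"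
begin

text \<open>Each step of the construction multiplies the size of the code by exactly
  \<open>(q^(3K) - 1) q^K\<close>. Indeed, suppose \<open>\<beta> \<Phi>(U) = \<beta>' \<Phi>'(V)\<close>. Taking the quotient of the images of two
  vectors that are independent over the field of order \<open>q\<close> eliminates \<open>\<beta>\<close> and \<open>\<beta>'\<close>; cross-multiplying
  gives a relation between \<open>1, \<gamma>, \<gamma>^2\<close>, which are independent over the field of order \<open>q^K\<close>. Its three
  coefficients force, in turn, a common ratio \<open>\<lambda>\<close> between the vectors of \<open>U\<close> and \<open>V\<close>; then
  \<open>\<lambda>^(q-1) = \<omega>^(j-j')\<close>, whence \<open>j = j'\<close> and \<open>\<lambda>\<close> lies in the field of order \<open>q\<close>; and finally \<open>a = a'\<close>.
  So the parametrisation is injective up to scaling \<open>\<beta>\<close> by that field. With \<open>Q = q^(2(n-k))\<close> and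
  \<open>x = 1 - 1/q^(k-1)\<close>, the resulting product lies between \<open>x^e Q\<close> and \<open>Q\<close>, and the Johnson bound between
  \<open>Q\<close> and \<open>Q / x^2\<close>.\<close>

subsection \<open>Finite fields and their subfields\<close>

text \<open>Multiplication by \<open>x\<close> shifts the index of the sum, multiplication by
  \<open>y\<close> does not; Pascal's rule recombines the two.\<close>

lemma (in cring) binomial_expansion:
  assumes x: "x \<in> carrier R" and y: "y \<in> carrier R"
  shows "(x \<oplus> y) [^] (n::nat) = (\<Oplus>i\<in>{..n}. [(n choose i)] \<cdot> (x [^] i \<otimes> y [^] (n - i)))"
proof (induction n)
  case 0
  show ?case using x y by simp
next
  case (Suc n)
  define S where "S = (\<Oplus>i\<in>{..n}. [(n choose i)] \<cdot> (x [^] i \<otimes> y [^] (n - i)))"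
  have S: "S \<in> carrier R"
    unfolding S_def using x y by (intro finsum_closed) auto
  define T where "T = (\<Oplus>i\<in>{..n}. [(n choose Suc i)] \<cdot> (x [^] Suc i \<otimes> y [^] (n - i)))"
  have T: "T \<in> carrier R"
    unfolding T_def using x y by (intro finsum_closed) auto
  have xS: "S \<otimes> x = (\<Oplus>i\<in>{..n}. [(n choose i)] \<cdot> (x [^] Suc i \<otimes> y [^] (n - i)))"
    unfolding S_def using x y
    by (subst finsum_ldistr) (auto intro!: finsum_cong' simp: add_pow_ldistr add_pow_rdistr m_ac)
  have "S \<otimes> y = (\<Oplus>i\<in>{..n}. [(n choose i)] \<cdot> (x [^] i \<otimes> y [^] (Suc n - i)))"
    unfolding S_def using x y
    by (subst finsum_ldistr) (auto intro!: finsum_cong' simp: add_pow_ldistr add_pow_rdistr m_ac Suc_diff_le)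
  \<comment> \<open>The added summand vanishes because \<open>n choose Suc n = 0\<close>; it makes
    the range fit the index shift that splits off the pure power of \<open>y\<close>.\<close>
  also have "\<dots> = (\<Oplus>i\<in>{..Suc n}. [(n choose i)] \<cdot> (x [^] i \<otimes> y [^] (Suc n - i)))"
    using x y by (subst finsum_Suc) (auto simp: binomial_eq_0)
  also have "\<dots> = T \<oplus> y [^] Suc n"
    unfolding T_def using x y by (subst finsum_Suc2) (auto simp del: nat_pow_Suc)
  finally have yS: "S \<otimes> y = T \<oplus> y [^] Suc n" .
  have "(\<Oplus>i\<in>{..Suc n}. [(Suc n choose i)] \<cdot> (x [^] i \<otimes> y [^] (Suc n - i)))
      = (\<Oplus>i\<in>{..n}. [(Suc n choose Suc i)] \<cdot> (x [^] Suc i \<otimes> y [^] (n - i))) \<oplus> y [^] Suc n"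
    using x y by (subst finsum_Suc2) (auto simp del: nat_pow_Suc binomial_Suc_Suc)
  also have "(\<Oplus>i\<in>{..n}. [(Suc n choose Suc i)] \<cdot> (x [^] Suc i \<otimes> y [^] (n - i))) = S \<otimes> x \<oplus> T"
    unfolding xS T_def using x y
    by (subst finsum_addf[symmetric])
       (auto intro!: finsum_cong' simp: add.nat_pow_mult simp del: nat_pow_Suc)
  also have "S \<otimes> x \<oplus> T \<oplus> y [^] Suc n = S \<otimes> (x \<oplus> y)"
    using x y S T yS by (simp add: r_distr a_assoc del: nat_pow_Suc)
  finally show ?case
    using Suc.IH x y by (simp add: S_def del: binomial_Suc_Suc)
qed

text \<open>All binomial coefficients strictly between the two ends are divisible by
  \<open>p\<close>.\<close>

lemma (in cring) freshmans_dream: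
  assumes p: "prime p" and char: "[p] \<cdot> \<one> = \<zero>"
    and x: "x \<in> carrier R" and y: "y \<in> carrier R"
  shows "(x \<oplus> y) [^] p = x [^] p \<oplus> y [^] (p::nat)"
proof -
  have char': "[p] \<cdot> z = \<zero>" if "z \<in> carrier R" for z
    using add_pow_ldistr[of \<one> z p] char that by simp
  \<comment> \<open>In this form both end terms can be split off, and the inner terms are indexed by
    \<open>i \<le> m\<close>.\<close>
  obtain m where m: "p = Suc (Suc m)"
    using prime_ge_2_nat[OF p] by (metis add_2_eq_Suc le_iff_add)
  have mid: "[(p choose Suc i)] \<cdot> (x [^] Suc i \<otimes> y [^] (p - Suc i)) = \<zero>" if "i \<le> m" for i
  proof -
    have "p dvd p choose Suc i"
      using p that m by (intro dvd_choose_prime) auto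
    then obtain c where "p choose Suc i = p * c" by blast
    with x y char' show ?thesis
      by (simp add: add.nat_pow_pow[symmetric] del: nat_pow_Suc)
  qed
  have "(x \<oplus> y) [^] p = (\<Oplus>i\<in>{..Suc (Suc m)}. [(p choose i)] \<cdot> (x [^] i \<otimes> y [^] (p - i)))"
    using binomial_expansion[OF x y, of p] m by simp
  also have "\<dots> = (\<Oplus>i\<in>{..Suc m}. [(p choose Suc i)] \<cdot> (x [^] Suc i \<otimes> y [^] (p - Suc i))) \<oplus> y [^] p"
    using x y by (subst finsum_Suc2) (auto simp del: nat_pow_Suc)
  also have "(\<Oplus>i\<in>{..Suc m}. [(p choose Suc i)] \<cdot> (x [^] Suc i \<otimes> y [^] (p - Suc i)))
     = x [^] p \<oplus> (\<Oplus>i\<in>{..m}. [(p choose Suc i)] \<cdot> (x [^] Suc i \<otimes> y [^] (p - Suc i)))"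
    using x y m by (subst finsum_Suc) (auto simp del: nat_pow_Suc)
  also have "(\<Oplus>i\<in>{..m}. [(p choose Suc i)] \<cdot> (x [^] Suc i \<otimes> y [^] (p - Suc i))) = \<zero>"
    using finsum_cong'[of "{..m}" "{..m}" "\<lambda>_. \<zero>"] mid by (simp add: finsum_zero del: nat_pow_Suc)
  finally show ?thesis using x y by simp
qed

lemma (in cring) freshmans_dream_power:
  assumes p: "prime p" and char: "[p] \<cdot> \<one> = \<zero>"
    and x: "x \<in> carrier R" and y: "y \<in> carrier R"
  shows "(x \<oplus> y) [^] (p ^ s) = x [^] (p ^ s) \<oplus> y [^] (p ^ s :: nat)"
proof (induction s)
  case (Suc s)
  have "(x \<oplus> y) [^] (p ^ Suc s) = ((x \<oplus> y) [^] (p ^ s)) [^] p"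
    using x y by (simp add: nat_pow_pow mult.commute)
  also have "\<dots> = (x [^] (p ^ s)) [^] p \<oplus> (y [^] (p ^ s)) [^] p"
    unfolding Suc.IH using x y by (intro freshmans_dream p char) auto
  finally show ?case using x y by (simp add: nat_pow_pow mult.commute)
qed (use x y in simp)

text \<open>Lagrange's theorem in the additive group kills \<open>p ^ s\<close> times the unit;
  without zero divisors one of the factors \<open>p\<close> must already do so.\<close>

lemma (in domain) char_prime_of_card:
  assumes "card (carrier R) = p ^ s" and fin: "finite (carrier R)"
  shows "[p] \<cdot> \<one> = \<zero>"
proof -
  have "[(p ^ s)] \<cdot> \<one> = \<zero>"
    using group.pow_order_eq_1[OF a_group, of \<one>] assms
    by (simp add: order_def add_pow_def)
  then show ?thesis
  proof (induction s)
    case (Suc s)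
    have "[(p ^ Suc s)] \<cdot> \<one> = ([p] \<cdot> \<one>) \<otimes> ([(p ^ s)] \<cdot> \<one>)"
      by (simp add: add_pow_ldistr add.nat_pow_pow mult.commute)
    with Suc show ?case using integral by fastforce
  qed simp
qed

text \<open>Subtracting the equations in pairs and dividing by the differences of the roots lowers
  the degree until only \<open>c2\<close> is left.\<close>

lemma (in domain) quadratic_three_roots:
  assumes c: "c0 \<in> carrier R" "c1 \<in> carrier R" "c2 \<in> carrier R"
    and X: "x \<in> carrier R" "y \<in> carrier R" "z \<in> carrier R"
    and ne: "x \<noteq> y" "y \<noteq> z" "x \<noteq> z"
    and rx: "c0 \<oplus> c1 \<otimes> x \<oplus> c2 \<otimes> (x \<otimes> x) = \<zero>"
    and ry: "c0 \<oplus> c1 \<otimes> y \<oplus> c2 \<otimes> (y \<otimes> y) = \<zero>"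
    and rz: "c0 \<oplus> c1 \<otimes> z \<oplus> c2 \<otimes> (z \<otimes> z) = \<zero>"
  shows "c0 = \<zero> \<and> c1 = \<zero> \<and> c2 = \<zero>"
proof -
  have *: "c1 \<oplus> c2 \<otimes> (x \<oplus> t) = \<zero>"
    if t: "t \<in> carrier R" "x \<noteq> t" and rt: "c0 \<oplus> c1 \<otimes> t \<oplus> c2 \<otimes> (t \<otimes> t) = \<zero>" for t
  proof -
    have "(x \<ominus> t) \<otimes> (c1 \<oplus> c2 \<otimes> (x \<oplus> t)) =
        (c0 \<oplus> c1 \<otimes> x \<oplus> c2 \<otimes> (x \<otimes> x)) \<ominus> (c0 \<oplus> c1 \<otimes> t \<oplus> c2 \<otimes> (t \<otimes> t))"
      using c X t(1) by algebra
    then have "(x \<ominus> t) \<otimes> (c1 \<oplus> c2 \<otimes> (x \<oplus> t)) = \<zero>"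
      unfolding rx rt by simp
    moreover have "x \<ominus> t \<noteq> \<zero>"
      using t X by simp
    ultimately show ?thesis
      using c X t by (meson a_closed integral m_closed minus_closed)
  qed
  have "c2 \<otimes> (y \<ominus> z) = (c1 \<oplus> c2 \<otimes> (x \<oplus> y)) \<ominus> (c1 \<oplus> c2 \<otimes> (x \<oplus> z))"
    using c X by algebra
  then have "c2 \<otimes> (y \<ominus> z) = \<zero>"
    using *[OF X(2) ne(1) ry] *[OF X(3) ne(3) rz] by simp
  moreover have "y \<ominus> z \<noteq> \<zero>"
    using X ne by simp
  ultimately have c2: "c2 = \<zero>"
    using c X integral by blast
  then have c1: "c1 = \<zero>"
    using *[OF X(2) ne(1) ry] c X by simp
  show ?thesis
    using c2 c1 rx c X by simp
qed

lemma (in domain) nat_pow_nonzero: "x \<in> carrier R \<Longrightarrow> x \<noteq> \<zero> \<Longrightarrow> x [^] (j::nat) \<noteq> \<zero>"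
  by (induction j) (auto simp: integral_iff)

section \<open>Subfields as fixed points of powers of the Frobenius map\<close>

locale finite_field_order = field R for R (structure) +
  fixes q n :: nat
  assumes primepow_q: "primepow q"
    and finite_R: "finite (carrier R)"
    and card_R: "card (carrier R) = q ^ n"
begin

abbreviation F :: "nat \<Rightarrow> 'a set" where
  "F \<equiv> subfld R q"

lemma q_ge_2: "q \<ge> 2"
  using primepow_gt_Suc_0[OF primepow_q] by simp

lemma n_pos: "n > 0"
proof (rule ccontr)
  assume "\<not> n > 0"
  then have "card (carrier R) = 1"
    using card_R by simp
  then obtain x where "carrier R = {x}"
    using card_1_singletonE by blast
  then show False
    using one_closed zero_closed one_not_zero by auto
qed

lemma subfld_carrier: "x \<in> F m \<Longrightarrow> x \<in> carrier R"
  by (simp add: subfld_def)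

lemma subfld_pow: "x \<in> F m \<Longrightarrow> x [^] (q ^ m) = x"
  by (simp add: subfld_def)

lemma finite_subfld [simp]: "finite (F m)"
  using finite_R by (simp add: subfld_def)

lemma add_pow_q:
  assumes "x \<in> carrier R" "y \<in> carrier R"
  shows "(x \<oplus> y) [^] (q ^ m) = x [^] (q ^ m) \<oplus> y [^] (q ^ m)"
proof -
  obtain p r where pr: "prime p" "q = p ^ r"
    using primepow_q by (auto simp: primepow_def)
  have "[p] \<cdot> \<one> = \<zero>"
    using char_prime_of_card[of p "r * n"] card_R finite_R pr by (simp add: power_mult)
  then show ?thesis
    using freshmans_dream_power[OF pr(1) _ assms, of "r * m"] pr by (simp add: power_mult)
qed

text \<open>The fixed points of a field endomorphism form a subfield; closure under sums is the
  additivity of the Frobenius power.\<close>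

lemma subfld_subfield: "subfield (F m) R"
proof (rule subfieldI')
  have q0: "q ^ m > 0"
    using q_ge_2 by simp
  show "subring (F m) R"
  proof (rule subringI)
    show "\<ominus> h \<in> F m" if h: "h \<in> F m" for h
    proof -
      have hc: "h \<in> carrier R"
        using h by (rule subfld_carrier)
      \<comment> \<open>Additivity applied to the sum of \<open>h\<close> and its negative avoids a
        case distinction on the parity of \<open>q\<close>.\<close>
      have "h [^] (q ^ m) \<oplus> (\<ominus> h) [^] (q ^ m) = \<zero>"
        using add_pow_q[of h "\<ominus> h" m] hc q0 by (simp add: r_neg nat_pow_zero)
      then have "(\<ominus> h) [^] (q ^ m) = \<ominus> h"
        using hc subfld_pow[OF h] by (metis a_inv_closed minus_equality a_comm nat_pow_closed)
      then show ?thesis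
        using hc by (simp add: subfld_def)
    qed
    show "h1 \<otimes> h2 \<in> F m" if "h1 \<in> F m" "h2 \<in> F m" for h1 h2
      using that by (simp add: subfld_def nat_pow_distrib)
    show "h1 \<oplus> h2 \<in> F m" if "h1 \<in> F m" "h2 \<in> F m" for h1 h2
      using that by (simp add: subfld_def add_pow_q)
  qed (auto simp: subfld_def)
  show "inv h \<in> F m" if h: "h \<in> F m - {\<zero>}" for h
  proof -
    have hU: "h \<in> Units R"
      unfolding field_Units using h subfld_carrier by blast
    then have hc: "h \<in> carrier R" "inv h \<in> carrier R" and h1: "h \<otimes> inv h = \<one>"
      by (simp_all add: Units_closed)
    have "h \<otimes> (inv h) [^] (q ^ m) = (h \<otimes> inv h) [^] (q ^ m)"
      using hc subfld_pow[of h m] h by (simp add: nat_pow_distrib)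
    also have "\<dots> = h \<otimes> inv h"
      by (simp add: h1)
    finally have "(inv h) [^] (q ^ m) = inv h"
      using hc hU Units_l_cancel[of h "inv h [^] (q ^ m)" "inv h"] by blast
    then show ?thesis
      using hc by (simp add: subfld_def)
  qed
qed

lemma
  shows subfld_zero [simp]: "\<zero> \<in> F m"
    and subfld_one [simp]: "\<one> \<in> F m"
    and subfld_add: "x \<in> F m \<Longrightarrow> y \<in> F m \<Longrightarrow> x \<oplus> y \<in> F m"
    and subfld_mult: "x \<in> F m \<Longrightarrow> y \<in> F m \<Longrightarrow> x \<otimes> y \<in> F m"
    and subfld_uminus: "x \<in> F m \<Longrightarrow> \<ominus> x \<in> F m"
  using subringE(2,3,5,6,7)[OF subfieldE(1)[OF subfld_subfield[of m]]] by auto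

lemma subfld_minus: "x \<in> F m \<Longrightarrow> y \<in> F m \<Longrightarrow> x \<ominus> y \<in> F m"
  by (simp add: minus_eq subfld_add subfld_uminus)

lemma subfld_inv: "x \<in> F m \<Longrightarrow> x \<noteq> \<zero> \<Longrightarrow> inv x \<in> F m"
  using subfield_m_inv(1)[OF subfld_subfield, of x m] by simp

lemma subfld_nat_pow: "x \<in> F m \<Longrightarrow> x [^] (i::nat) \<in> F m"
  by (induction i) (auto intro: subfld_mult)

lemma subfld_mono:
  assumes "a dvd b" "x \<in> F a"
  shows "x \<in> F b"
proof -
  have "x [^] (q ^ (a * j)) = x" for j
    using assms(2)
    by (induction j) (simp_all add: subfld_def power_add nat_pow_pow[symmetric])
  with assms show ?thesis
    by (auto simp: subfld_def)
qed

lemma subfld_1: "x \<in> F 1 \<Longrightarrow> x \<in> F m"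
  by (rule subfld_mono[of 1]) auto

text \<open>The nonzero elements are the roots of x^d = 1 with d = q^m - 1. The degree bounds their
  number by d. Conversely d divides q^n - 1, so the cyclic multiplicative group contains d of
  them.\<close>

lemma card_subfld:
  assumes m: "m dvd n"
  shows "card (F m) = q ^ m"
proof -
  define d where "d = q ^ m - 1"
  have "m > 0"
    using m n_pos by (auto intro: Nat.gr0I)
  then have d: "d > 0"
    unfolding d_def using q_ge_2 one_less_power[of q m] by simp
  have qm: "q ^ m = Suc d"
    using q_ge_2 by (simp add: d_def)
  have split: "F m = insert \<zero> {x \<in> carrier R. x [^] d = \<one>}"
  proof -
    have "x [^] (q ^ m) = x \<longleftrightarrow> x [^] d = \<one>" if "x \<in> carrier R" "x \<noteq> \<zero>" for x
    proof -
      have "x [^] (q ^ m) = x [^] d \<otimes> x"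
        by (simp add: qm)
      then show ?thesis
        using that by (metis l_one m_rcancel nat_pow_closed one_closed)
    qed
    moreover have "\<zero> [^] (q ^ m) = \<zero>"
      by (simp add: qm)
    moreover have "\<zero> [^] d \<noteq> \<one>"
      using d by (simp add: nat_pow_zero)
    ultimately show ?thesis
      by (auto simp: subfld_def)
  qed
  have "card {x \<in> carrier R. x [^] d = \<one>} = d"
  proof (rule antisym)
    show "card {x \<in> carrier R. x [^] d = \<one>} \<le> d"
      using num_roots_le_deg[OF finite_R] d by simp
    obtain a where a: "a \<in> carrier (mult_of R)"
      and gen: "carrier (mult_of R) = {a [^] i | i::nat. i \<in> UNIV}"
      using finite_field_mult_group_has_gen[OF finite_R] by blast
    interpret M: group "mult_of R"
      rewrites "([^]\<^bsub>mult_of R\<^esub>) = (([^]) :: _ \<Rightarrow> nat \<Rightarrow> _)" and "\<one>\<^bsub>mult_of R\<^esub> = \<one>"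
      by (simp_all add: field_mult_group nat_pow_mult_of)
    have "M.ord a = order (mult_of R)"
      using M.generate_pow_card[OF a] M.generate_pow_on_finite_carrier[OF finite_mult_of[OF finite_R] a]
      by (simp only: order_def gen)
    then have orda: "M.ord a = q ^ n - 1"
      using order_mult_of[OF finite_R] card_R by (simp add: order_def)
    obtain j where j: "n = m * j"
      using m by blast
    \<comment> \<open>The factorisation of x^j - 1 is taken over the integers, where subtraction is
      not truncated.\<close>
    have "int (q ^ m) - 1 dvd int (q ^ m) ^ j - 1 ^ j"
      by (simp only: power_diff_sumr2 dvd_triv_left)
    then have "int d dvd int (q ^ n - 1)"
      using q_ge_2 by (simp add: d_def j power_mult of_nat_diff)
    then obtain c where c: "q ^ n - 1 = d * c"
      by (auto simp only: int_dvd_int_iff)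
    have "q ^ n > 1"
      using q_ge_2 n_pos one_less_power[of q n] by simp
    then have c0: "c > 0" "d * c > 0"
      using c d by (auto intro: Nat.gr0I)
    have ac: "a \<in> carrier R" "a \<noteq> \<zero>"
      using a by auto
    \<comment> \<open>The generator \<open>a\<close> has order \<open>d * c\<close>, so the first
      \<open>d\<close> powers of \<open>a [^] c\<close> are distinct roots of x^d = 1.\<close>
    have "inj_on (\<lambda>i. (a [^] c) [^] i) {..<d}"
    proof (rule inj_onI)
      fix i i' assume i: "i \<in> {..<d}" "i' \<in> {..<d}" and eq: "(a [^] c) [^] i = (a [^] c) [^] i'"
      have "c * t \<le> M.ord a - 1" if "t < d" for t
      proof -
        have "c * t < c * d"
          using that c0 by simp
        moreover have "M.ord a = c * d"
          using orda c by simp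
        ultimately show ?thesis
          by linarith
      qed
      then have "c * i = c * i'"
        using inj_onD[OF M.ord_inj[OF a], of "c * i" "c * i'"] i eq ac by (simp add: nat_pow_pow)
      then show "i = i'"
        using c0 by simp
    qed
    moreover have "(a [^] c) [^] i \<in> {x \<in> carrier R. x [^] d = \<one>}" for i :: nat
    proof -
      have "((a [^] c) [^] i) [^] d = (a [^] M.ord a) [^] i"
        using ac orda c by (simp add: nat_pow_pow mult_ac)
      also have "\<dots> = \<one>"
        using M.pow_ord_eq_1[OF a] by simp
      finally show ?thesis
        using ac by simp
    qed
    ultimately show "d \<le> card {x \<in> carrier R. x [^] d = \<one>}"
      using card_inj_on_le[of "\<lambda>i. (a [^] c) [^] i" "{..<d}" "{x \<in> carrier R. x [^] d = \<one>}"] finite_R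
      by (simp add: image_subset_iff)
  qed
  moreover have "\<zero> \<notin> {x \<in> carrier R. x [^] d = \<one>}"
    using d by (simp add: nat_pow_zero)
  ultimately have "card (F m) = Suc d"
    unfolding split using finite_R by (subst card_insert_disjoint) auto
  then show ?thesis
    by (simp add: qm)
qed

end

subsection \<open>One step of the construction\<close>

text \<open>The equation says (m1 - m2)(x - y) = 0. This shape arises twice when coefficients are
  compared in \<open>Phi_collision\<close>.\<close>

lemma (in domain) cross_sum_cancel:
  assumes m: "m1 \<in> carrier R" "m2 \<in> carrier R" and X: "x \<in> carrier R" "y \<in> carrier R" "x \<noteq> y"
    and eq: "m1 \<otimes> x \<oplus> m2 \<otimes> y = m2 \<otimes> x \<oplus> m1 \<otimes> y"
  shows "m1 = m2"
proof -
  have "(m1 \<ominus> m2) \<otimes> (x \<ominus> y) = (m1 \<otimes> x \<oplus> m2 \<otimes> y) \<ominus> (m2 \<otimes> x \<oplus> m1 \<otimes> y)"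
    using m X by algebra
  also have "\<dots> = \<zero>"
    unfolding eq using m X by simp
  finally show ?thesis
    using m X by (simp add: integral_iff)
qed

text \<open>One cubic layer of the tower. The bound on \<open>K\<close> ensures
  \<open>q < q ^ K\<close>, from which \<open>w_nonzero\<close> follows.\<close>

locale cubic_step = finite_field_order +
  fixes K :: nat and w g :: 'a
  assumes K_ge_2: "K \<ge> 2"
    and dvd_n: "3 * K dvd n"
    and prim: "primitive_elem R q K w"
    and g_in: "g \<in> F (3 * K)"
    and g_gen: "generate_field R (insert g (F K)) = F (3 * K)"
begin

lemma K_dvd: "K dvd n"
  using dvd_n dvd_mult_right by blast

lemma g_carrier: "g \<in> carrier R"
  using g_in by (rule subfld_carrier)

lemma subfld_K_3K: "x \<in> F K \<Longrightarrow> x \<in> F (3 * K)"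
  by (rule subfld_mono) auto

lemma g_not_in_subfld: "g \<notin> F K"
proof
  assume "g \<in> F K"
  then have "F (3 * K) \<subseteq> F K"
    using generate_field_min_subfield1[OF _ subfld_subfield[of K], of "insert g (F K)"]
      subfld_carrier g_gen by auto
  then have "q ^ (3 * K) \<le> q ^ K"
    using card_mono[OF finite_subfld, of "F (3 * K)" K] card_subfld[OF dvd_n] card_subfld[OF K_dvd]
    by simp
  moreover have "q ^ K < q ^ (3 * K)"
    using q_ge_2 K_ge_2 by (intro power_strict_increasing) auto
  ultimately show False
    by simp
qed

text \<open>The Frobenius conjugates of \<open>g\<close> over the subfield of order \<open>q\<^sup>K\<close> are three distinct roots of
  any quadratic relation.\<close>

lemma quadratic_relation_zero:
  assumes c: "c0 \<in> F K" "c1 \<in> F K" "c2 \<in> F K"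
    and rel: "c0 \<oplus> c1 \<otimes> g \<oplus> c2 \<otimes> (g \<otimes> g) = \<zero>"
  shows "c0 = \<zero> \<and> c1 = \<zero> \<and> c2 = \<zero>"
proof -
  define s where "s x = x [^] (q ^ K)" for x
  have s_closed [simp]: "s x \<in> carrier R" if "x \<in> carrier R" for x
    using that by (simp add: s_def)
  have cc: "c0 \<in> carrier R" "c1 \<in> carrier R" "c2 \<in> carrier R"
    using c subfld_carrier by auto
  have step: "c0 \<oplus> c1 \<otimes> s x \<oplus> c2 \<otimes> (s x \<otimes> s x) = \<zero>"
    if x: "x \<in> carrier R" and relx: "c0 \<oplus> c1 \<otimes> x \<oplus> c2 \<otimes> (x \<otimes> x) = \<zero>" for x
  proof -
    have "s (c0 \<oplus> c1 \<otimes> x \<oplus> c2 \<otimes> (x \<otimes> x)) = c0 \<oplus> c1 \<otimes> s x \<oplus> c2 \<otimes> (s x \<otimes> s x)"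
      using cc x c subfld_pow by (simp add: s_def add_pow_q nat_pow_distrib)
    then show ?thesis
      unfolding relx using q_ge_2 by (simp add: s_def nat_pow_zero)
  qed
  have s3: "s (s (s g)) = g"
    using g_carrier subfld_pow[OF g_in]
    by (simp add: s_def nat_pow_pow power_add[symmetric] mult_2 numeral_3_eq_3 ac_simps)
  have ne1: "g \<noteq> s g"
    using g_not_in_subfld g_carrier by (auto simp: s_def subfld_def)
  \<comment> \<open>Since \<open>s\<close> has order dividing 3 on \<open>g\<close>, any coincidence
    among the three conjugates would, after applying \<open>s\<close>, give
    \<open>s g = g\<close>.\<close>
  have ne3: "g \<noteq> s (s g)"
    using s3 ne1 by metis
  have ne2: "s g \<noteq> s (s g)"
    using s3 ne1 by metis
  show ?thesis
    using quadratic_three_roots[OF cc g_carrier _ _ ne1 ne2 ne3 rel] step g_carrier rel by simp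
qed

lemma quadratic_coeffs_unique:
  assumes c: "c0 \<in> F K" "c1 \<in> F K" "c2 \<in> F K"
    and d: "d0 \<in> F K" "d1 \<in> F K" "d2 \<in> F K"
    and eq: "c0 \<oplus> c1 \<otimes> g \<oplus> c2 \<otimes> (g \<otimes> g) = d0 \<oplus> d1 \<otimes> g \<oplus> d2 \<otimes> (g \<otimes> g)"
  shows "c0 = d0 \<and> c1 = d1 \<and> c2 = d2"
proof -
  have cc: "c0 \<in> carrier R" "c1 \<in> carrier R" "c2 \<in> carrier R"
    "d0 \<in> carrier R" "d1 \<in> carrier R" "d2 \<in> carrier R"
    using c d subfld_carrier by auto
  have "(c0 \<ominus> d0) \<oplus> (c1 \<ominus> d1) \<otimes> g \<oplus> (c2 \<ominus> d2) \<otimes> (g \<otimes> g) =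
     (c0 \<oplus> c1 \<otimes> g \<oplus> c2 \<otimes> (g \<otimes> g)) \<ominus> (d0 \<oplus> d1 \<otimes> g \<oplus> d2 \<otimes> (g \<otimes> g))"
    using cc g_carrier by algebra
  also have "\<dots> = \<zero>"
    unfolding eq using cc g_carrier by simp
  finally show ?thesis
    using quadratic_relation_zero[of "c0 \<ominus> d0" "c1 \<ominus> d1" "c2 \<ominus> d2"] c d cc
    by (simp add: subfld_minus)
qed

section \<open>Exponents of the primitive element\<close>

lemma w_in: "w \<in> F K"
  using prim by (simp add: primitive_elem_def)

lemma w_pow_image: "(\<lambda>j::nat. w [^] j) ` {..<q ^ K - 1} = F K - {\<zero>}"
  using prim by (simp add: primitive_elem_def)

lemma q_less_card: "q < q ^ K"
  using q_ge_2 K_ge_2 power_strict_increasing[of 1 K q] by simp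

lemma w_nonzero: "w \<noteq> \<zero>"
proof -
  have "1 \<in> {..<q ^ K - 1}"
    using q_less_card q_ge_2 by simp
  then have "w [^] (1::nat) \<in> F K - {\<zero>}"
    unfolding w_pow_image[symmetric] by (rule imageI)
  then show ?thesis
    using w_in subfld_carrier by auto
qed

lemma w_carrier: "w \<in> carrier R"
  using w_in by (rule subfld_carrier)

text \<open>The order of \<open>w\<close> is exactly q^K - 1: that power is the unit, and the
  smaller powers are distinct because they fill a set of q^K - 1 elements.\<close>

lemma w_pow_eq_imp_cong:
  assumes eq: "w [^] s = w [^] (t::nat)"
  shows "s mod (q ^ K - 1) = t mod (q ^ K - 1)"
proof -
  define M where "M = q ^ K - 1"
  have M: "q ^ K = Suc M" "M > 0"
    using q_less_card q_ge_2 unfolding M_def by linarith+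
  have "w [^] M \<otimes> w = \<one> \<otimes> w"
    using subfld_pow[OF w_in] w_carrier by (simp add: M)
  then have wM: "w [^] M = \<one>"
    using m_rcancel[OF w_nonzero w_carrier] w_carrier by blast
  have red: "w [^] s = w [^] (s mod M)" for s
  proof -
    have "w [^] s = w [^] (M * (s div M) + s mod M)"
      by simp
    also have "\<dots> = (w [^] M) [^] (s div M) \<otimes> w [^] (s mod M)"
      by (simp only: nat_pow_mult[OF w_carrier, symmetric] nat_pow_pow[OF w_carrier])
    finally show ?thesis
      using w_carrier by (simp add: wM)
  qed
  have "card (F K - {\<zero>}) = M"
    using card_subfld[OF K_dvd] by (simp add: M_def)
  then have "inj_on (\<lambda>j::nat. w [^] j) {..<M}"
    using w_pow_image by (intro eq_card_imp_inj_on) (simp_all add: M_def)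
  moreover have "w [^] (s mod M) = w [^] (t mod M)"
    using eq red by metis
  ultimately show ?thesis
    using M unfolding M_def[symmetric] by (auto dest!: inj_onD)
qed

text \<open>With l = w^m the equation becomes j' + mq = j + m modulo q^K - 1. Modulo the divisor q -
  1, where q is 1, the unknown m drops out, and the range of the exponents turns the congruence into
  equality. Cancelling the power of \<open>w\<close> then leaves l^q = l.\<close>

lemma twisted_scalar:
  assumes l: "l \<in> F K" "l \<noteq> \<zero>" and j: "j \<le> q - 2" "j' \<le> q - 2"
    and eq: "w [^] j' \<otimes> l [^] q = w [^] j \<otimes> l"
  shows "j = j' \<and> l \<in> F 1"
proof -
  obtain m :: nat where m: "l = w [^] m"
    using l unfolding w_pow_image[symmetric] by (metis DiffI empty_iff imageE insert_iff w_pow_image)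
  have "w [^] (j' + m * q) = w [^] (j + m)"
    using eq w_carrier by (simp add: m nat_pow_pow nat_pow_mult)
  then have "[j' + m * q = j + m] (mod (q ^ K - 1))"
    unfolding cong_def by (rule w_pow_eq_imp_cong)
  moreover have "q - 1 dvd q ^ K - 1"
  proof -
    have "int q - 1 dvd int q ^ K - 1 ^ K"
      by (simp only: power_diff_sumr2 dvd_triv_left)
    then have "int (q - 1) dvd int (q ^ K - 1)"
      using q_ge_2 by (simp add: of_nat_diff)
    then show ?thesis
      by (simp only: int_dvd_int_iff)
  qed
  ultimately have c1: "[j' + m * q = j + m] (mod (q - 1))"
    by (rule cong_dvd_modulus_nat)
  have c2: "[j' + m * q = j' + m * 1] (mod (q - 1))"
    using q_ge_2 by (intro cong_add cong_mult cong_refl) (simp add: cong_altdef_nat)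
  have "[j' + m = j + m] (mod (q - 1))"
    using cong_trans[OF cong_sym[OF c2] c1] by simp
  then have "[j' = j] (mod (q - 1))"
    by (simp add: cong_add_rcancel_nat)
  moreover have "j < q - 1" "j' < q - 1"
    using j q_ge_2 by auto
  ultimately have jj: "j = j'"
    by (simp add: cong_def)
  then have "l [^] q = l"
    using eq l subfld_carrier w_carrier nat_pow_nonzero[OF w_carrier w_nonzero]
    by (simp add: m_lcancel)
  then show ?thesis
    using jj subfld_carrier[OF l(1)] by (simp add: subfld_def)
qed


section \<open>The maps \<open>Phi\<close> and their collisions\<close>

lemma Phi_carrier: "u \<in> carrier R \<Longrightarrow> a \<in> carrier R \<Longrightarrow> Phi R q w g a j u \<in> carrier R"
  using g_carrier w_carrier by (simp add: Phi_def)

lemma Phi_in: "u \<in> F K \<Longrightarrow> a \<in> F K \<Longrightarrow> Phi R q w g a j u \<in> F (3 * K)"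
  unfolding Phi_def using g_in w_in subfld_K_3K
  by (intro subfld_add subfld_mult subfld_nat_pow) auto

lemma Phi_coeff_in: "u \<in> F K \<Longrightarrow> a \<in> F K \<Longrightarrow> w [^] (j::nat) \<otimes> (u [^] q \<oplus> a \<otimes> u) \<in> F K"
  using w_in by (intro subfld_add subfld_mult subfld_nat_pow) auto

text \<open>The assumption \<open>indep\<close> is the nonvanishing of the Moore determinant of
  \<open>u1\<close> and \<open>u2\<close>, that is, their independence over \<open>F 1\<close>. It
  is the factor cancelled in the coefficients of \<open>g\<close> and of its square.\<close>

lemma Phi_collision:
  assumes u: "u1 \<in> F K" "u2 \<in> F K" and v: "v1 \<in> F K" "v2 \<in> F K"
    and a: "a \<in> F K" "b \<in> F K" and j: "j \<le> q - 2" "j' \<le> q - 2"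
    and nz: "u1 \<noteq> \<zero>" "v1 \<noteq> \<zero>"
    and indep: "u1 \<otimes> u2 [^] q \<noteq> u2 \<otimes> u1 [^] q"
    and eq: "Phi R q w g a j u1 \<otimes> Phi R q w g b j' v2 = Phi R q w g b j' v1 \<otimes> Phi R q w g a j u2"
  shows "a = b \<and> j = j' \<and> (\<exists>c \<in> F 1. c \<noteq> \<zero> \<and> v1 = c \<otimes> u1)"
proof -
  have [simp]: "u1 \<in> carrier R" "u2 \<in> carrier R" "v1 \<in> carrier R" "v2 \<in> carrier R"
    "a \<in> carrier R" "b \<in> carrier R" "g \<in> carrier R" "w \<in> carrier R"
    using u v a subfld_carrier g_carrier w_carrier by auto
  define A B where "A x = w [^] j \<otimes> (x [^] q \<oplus> a \<otimes> x)" and "B x = w [^] j' \<otimes> (x [^] q \<oplus> b \<otimes> x)" for x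
  have AB: "A x \<in> F K" "B x \<in> F K" if "x \<in> F K" for x
    unfolding A_def B_def using that a by (simp_all add: Phi_coeff_in)
  have ABc [simp]: "A x \<in> carrier R" "B x \<in> carrier R" if "x \<in> F K" for x
    using AB[OF that] subfld_carrier by auto
  note [simp] = u v
  \<comment> \<open>All coefficients lie in \<open>F K\<close>, so uniqueness of coefficients splits
    the single equation into three.\<close>
  have expand: "(x \<oplus> s \<otimes> g) \<otimes> (y \<oplus> t \<otimes> g) =
       x \<otimes> y \<oplus> (x \<otimes> t \<oplus> s \<otimes> y) \<otimes> g \<oplus> (s \<otimes> t) \<otimes> (g \<otimes> g)"
    if "x \<in> carrier R" "s \<in> carrier R" "y \<in> carrier R" "t \<in> carrier R" for x s y t
    using that g_carrier by algebra
  have "(u1 \<oplus> A u1 \<otimes> g) \<otimes> (v2 \<oplus> B v2 \<otimes> g) = (v1 \<oplus> B v1 \<otimes> g) \<otimes> (u2 \<oplus> A u2 \<otimes> g)"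
    using eq by (simp add: Phi_def A_def B_def)
  then have "u1 \<otimes> v2 \<oplus> (u1 \<otimes> B v2 \<oplus> A u1 \<otimes> v2) \<otimes> g \<oplus> (A u1 \<otimes> B v2) \<otimes> (g \<otimes> g) =
    v1 \<otimes> u2 \<oplus> (v1 \<otimes> A u2 \<oplus> B v1 \<otimes> u2) \<otimes> g \<oplus> (B v1 \<otimes> A u2) \<otimes> (g \<otimes> g)"
    by (simp only: expand ABc u v \<open>u1 \<in> carrier R\<close> \<open>u2 \<in> carrier R\<close> \<open>v1 \<in> carrier R\<close> \<open>v2 \<in> carrier R\<close>)
  then have "u1 \<otimes> v2 = v1 \<otimes> u2 \<and> u1 \<otimes> B v2 \<oplus> A u1 \<otimes> v2 = v1 \<otimes> A u2 \<oplus> B v1 \<otimes> u2 \<and>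
      A u1 \<otimes> B v2 = B v1 \<otimes> A u2"
    by (rule quadratic_coeffs_unique[rotated -1]) (intro subfld_add subfld_mult AB u v)+
  then have coeffs: "u1 \<otimes> v2 = v1 \<otimes> u2"
    "u1 \<otimes> B v2 \<oplus> A u1 \<otimes> v2 = v1 \<otimes> A u2 \<oplus> B v1 \<otimes> u2"
    "A u1 \<otimes> B v2 = B v1 \<otimes> A u2"
    by blast+
  \<comment> \<open>The constant coefficients say that both pairs have this same ratio.\<close>
  define l where "l = v1 \<otimes> inv u1"
  have u1U: "u1 \<in> Units R"
    unfolding field_Units using nz u subfld_carrier by blast
  have l: "l \<in> F K"
    unfolding l_def using nz by (intro subfld_mult subfld_inv) auto
  then have lc [simp]: "l \<in> carrier R"
    by (rule subfld_carrier)
  have v1: "v1 = l \<otimes> u1"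
    using u1U by (simp add: l_def m_assoc)
  have "u1 \<otimes> v2 = u1 \<otimes> (l \<otimes> u2)"
    using coeffs(1) by (simp add: v1 m_ac)
  then have v2: "v2 = l \<otimes> u2"
    using nz m_lcancel[of u1 v2 "l \<otimes> u2"] by simp
  have l0: "l \<noteq> \<zero>"
    using nz v1 by auto
  define X Y where "X = u1 \<otimes> u2 [^] q" and "Y = u2 \<otimes> u1 [^] q"
  have XY: "X \<in> carrier R" "Y \<in> carrier R" "X \<noteq> Y"
    using indep by (simp_all add: X_def Y_def)
  define p1 p2 lq W W' where "p1 = u1 [^] q" and "p2 = u2 [^] q" and "lq = l [^] q"
    and "W = w [^] j" and "W' = w [^] j'"
  have cl [simp]: "p1 \<in> carrier R" "p2 \<in> carrier R" "lq \<in> carrier R" "W \<in> carrier R" "W' \<in> carrier R"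
    by (simp_all add: p1_def p2_def lq_def W_def W'_def)
  have XY_eqs: "X = u1 \<otimes> p2" "Y = u2 \<otimes> p1"
    by (simp_all add: X_def Y_def p1_def p2_def)
  have AB_eqs: "A u1 = W \<otimes> (p1 \<oplus> a \<otimes> u1)" "A u2 = W \<otimes> (p2 \<oplus> a \<otimes> u2)"
    "B v1 = W' \<otimes> (lq \<otimes> p1 \<oplus> b \<otimes> (l \<otimes> u1))" "B v2 = W' \<otimes> (lq \<otimes> p2 \<oplus> b \<otimes> (l \<otimes> u2))"
    by (simp_all add: A_def B_def v1 v2 p1_def p2_def lq_def W_def W'_def nat_pow_distrib)
  \<comment> \<open>The terms containing \<open>a\<close> or \<open>b\<close> agree on both sides.
    Removing them leaves a relation in \<open>X\<close> and \<open>Y\<close> alone, which ties the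
    ratio to the exponents \<open>j\<close> and \<open>j'\<close>.\<close>
  define C where "C = W' \<otimes> b \<otimes> (l \<otimes> u1 \<otimes> u2) \<oplus> W \<otimes> a \<otimes> (l \<otimes> u1 \<otimes> u2)"
  have [simp]: "C \<in> carrier R"
    by (simp add: C_def)
  have "u1 \<otimes> B v2 \<oplus> A u1 \<otimes> v2 = (W' \<otimes> lq) \<otimes> X \<oplus> (W \<otimes> l) \<otimes> Y \<oplus> C"
    unfolding AB_eqs unfolding v2 XY_eqs C_def by (simp add: r_distr l_distr m_ac a_ac)
  moreover have "v1 \<otimes> A u2 \<oplus> B v1 \<otimes> u2 = (W \<otimes> l) \<otimes> X \<oplus> (W' \<otimes> lq) \<otimes> Y \<oplus> C"
    unfolding AB_eqs unfolding v1 XY_eqs C_def by (simp add: r_distr l_distr m_ac a_ac)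
  ultimately have "(W' \<otimes> lq) \<otimes> X \<oplus> (W \<otimes> l) \<otimes> Y = (W \<otimes> l) \<otimes> X \<oplus> (W' \<otimes> lq) \<otimes> Y"
    using coeffs(2) XY by simp
  then have "W' \<otimes> lq = W \<otimes> l"
    by (rule cross_sum_cancel[rotated -1]) (use XY in simp_all)
  then have jl: "j = j'" "l \<in> F 1"
    using twisted_scalar[OF l l0 j] by (auto simp: W_def W'_def lq_def)
  have lq: "lq = l" and WW: "W' = W"
    using jl subfld_pow[OF jl(2)] by (simp_all add: lq_def W_def W'_def)
  have W0: "W \<noteq> \<zero>"
    unfolding W_def using w_carrier w_nonzero by (rule nat_pow_nonzero)
  \<comment> \<open>Once j = j' and l^q = l, the coefficient of the square of \<open>g\<close> has
    the common factor \<open>M\<close>; removing it and the part \<open>D\<close> common to both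
    sides leaves the same kind of relation, now for \<open>a\<close> and \<open>b\<close>.\<close>
  define M D where "M = W \<otimes> W \<otimes> l" and "D = p1 \<otimes> p2 \<oplus> a \<otimes> b \<otimes> (u1 \<otimes> u2)"
  have MD: "M \<in> carrier R" "M \<noteq> \<zero>" "D \<in> carrier R"
    using W0 l0 by (simp_all add: M_def D_def integral_iff)
  have "A u1 \<otimes> B v2 = M \<otimes> (a \<otimes> X \<oplus> b \<otimes> Y \<oplus> D)"
    unfolding AB_eqs lq WW unfolding XY_eqs M_def D_def by (simp add: r_distr l_distr m_ac a_ac)
  moreover have "B v1 \<otimes> A u2 = M \<otimes> (b \<otimes> X \<oplus> a \<otimes> Y \<oplus> D)"
    unfolding AB_eqs lq WW unfolding XY_eqs M_def D_def by (simp add: r_distr l_distr m_ac a_ac)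
  ultimately have "a \<otimes> X \<oplus> b \<otimes> Y \<oplus> D = b \<otimes> X \<oplus> a \<otimes> Y \<oplus> D"
    using coeffs(3) XY MD m_lcancel[of M] by simp
  then have "a \<otimes> X \<oplus> b \<otimes> Y = b \<otimes> X \<oplus> a \<otimes> Y"
    using XY MD by simp
  then have "a = b"
    by (rule cross_sum_cancel[rotated -1]) (use XY in simp_all)
  with jl l0 v1 show ?thesis
    by blast
qed

end

section \<open>Subspaces over the field of order q\<close>

text \<open>The dimension k is recorded by the cardinality q^k, so no theory of bases enters. Zero
  belongs to \<open>U\<close> because zero is an admissible scalar and \<open>U\<close> is
  nonempty.\<close>

definition (in finite_field_order) fq_space :: "nat \<Rightarrow> nat \<Rightarrow> 'a set \<Rightarrow> bool" where
  "fq_space m k U \<longleftrightarrow> U \<subseteq> F m \<and> card U = q ^ k \<and>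
     (\<forall>x\<in>U. \<forall>y\<in>U. x \<oplus> y \<in> U) \<and> (\<forall>c\<in>F 1. \<forall>x\<in>U. c \<otimes> x \<in> U)"

context finite_field_order
begin

lemma card_subfld_1: "card (F 1) = q"
  using card_subfld[of 1] by simp

text \<open>An injective map of a finite set into itself is onto.\<close>

lemma fq_space_scale:
  assumes U: "fq_space m k U" and c: "c \<in> F 1" "c \<noteq> \<zero>"
  shows "(\<lambda>x. c \<otimes> x) ` U = U"
proof -
  have "inj_on (\<lambda>x. c \<otimes> x) U"
  proof (rule inj_onI)
    fix x y assume xy: "x \<in> U" "y \<in> U" "c \<otimes> x = c \<otimes> y"
    moreover have "x \<in> carrier R" "y \<in> carrier R"
      using U xy subfld_carrier unfolding fq_space_def by blast+
    ultimately show "x = y"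
      using m_lcancel[OF c(2) subfld_carrier[OF c(1)]] by blast
  qed
  moreover have "(\<lambda>x. c \<otimes> x) ` U \<subseteq> U"
    using U c by (auto simp: fq_space_def)
  moreover have "finite U"
    using U finite_subfld finite_subset unfolding fq_space_def by blast
  ultimately show ?thesis
    by (simp add: endo_inj_surj)
qed

text \<open>For k at least 2 the space has more than q elements, so some \<open>y\<close> lies
  outside the line of \<open>x\<close>. Equality of the two products would make y/x a solution of
  c^q = c and put \<open>y\<close> back on that line.\<close>

lemma fq_space_indep_pair:
  assumes U: "fq_space m k U" and k: "k \<ge> 2"
  obtains x y where "x \<in> U" "y \<in> U" "x \<noteq> \<zero>" "x \<otimes> y [^] q \<noteq> y \<otimes> x [^] q"
proof -
  have fin: "finite U"
    using U finite_subfld finite_subset unfolding fq_space_def by blast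
  have UR: "U \<subseteq> carrier R"
    using U subfld_carrier unfolding fq_space_def by blast
  have big: "card U > q"
    using U k q_ge_2 power_strict_increasing[of 1 k q] by (simp add: fq_space_def)
  have "\<not> U \<subseteq> {\<zero>}"
    using big q_ge_2 card_mono[of "{\<zero>}" U] by auto
  then obtain x where x: "x \<in> U" "x \<noteq> \<zero>"
    by blast
  have "card ((\<lambda>c. c \<otimes> x) ` F 1) \<le> q"
    using card_image_le[OF finite_subfld, of "\<lambda>c. c \<otimes> x" 1] card_subfld_1 by simp
  then have "\<not> U \<subseteq> (\<lambda>c. c \<otimes> x) ` F 1"
    using big card_mono[of "(\<lambda>c. c \<otimes> x) ` F 1" U] by fastforce
  then obtain y where y: "y \<in> U" "y \<notin> (\<lambda>c. c \<otimes> x) ` F 1"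
    by blast
  have xc: "x \<in> carrier R" "y \<in> carrier R"
    using x y UR by auto
  have xU: "x \<in> Units R"
    unfolding field_Units using x xc by blast
  then have ix: "inv x \<in> carrier R" "inv x \<otimes> x = \<one>"
    by simp_all
  have "x \<otimes> y [^] q \<noteq> y \<otimes> x [^] q"
  proof
    assume eq: "x \<otimes> y [^] q = y \<otimes> x [^] q"
    define c where "c = y \<otimes> inv x"
    have cc: "c \<in> carrier R"
      using xc ix by (simp add: c_def)
    have ycx: "y = c \<otimes> x"
      using xc ix by (simp add: c_def m_assoc)
    have "(x \<otimes> x [^] q) \<otimes> c [^] q = (x \<otimes> x [^] q) \<otimes> c"
      using eq xc cc unfolding ycx by (simp add: nat_pow_distrib m_ac)
    moreover have "x \<otimes> x [^] q \<noteq> \<zero>"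
      using xc x nat_pow_nonzero[of x q] by (simp add: integral_iff)
    ultimately have "c [^] q = c"
      using xc cc m_lcancel[of "x \<otimes> x [^] q" "c [^] q" c] by simp
    then have "c \<in> F 1"
      using cc by (simp add: subfld_def)
    then show False
      using y ycx by blast
  qed
  with that x y show ?thesis by blast
qed

end

section \<open>Codewords and the redundancy of their parameters\<close>

context cubic_step
begin

lemma Phi_scale:
  assumes "c \<in> F 1" "u \<in> carrier R" "a \<in> carrier R"
  shows "Phi R q w g a j (c \<otimes> u) = c \<otimes> Phi R q w g a j u"
proof -
  have c: "c [^] q = c" "c \<in> carrier R"
    using assms(1) by (simp_all add: subfld_def)
  show ?thesis
    using c assms(2,3) g_carrier w_carrier
    by (simp add: Phi_def nat_pow_distrib r_distr l_distr m_ac a_ac)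
qed

lemma Phi_add:
  assumes "u \<in> carrier R" "v \<in> carrier R" "a \<in> carrier R"
  shows "Phi R q w g a j (u \<oplus> v) = Phi R q w g a j u \<oplus> Phi R q w g a j v"
  using assms g_carrier w_carrier add_pow_q[of u v 1]
  by (simp add: Phi_def r_distr l_distr m_ac a_ac)

text \<open>The argument is the constant coefficient of its image with respect to the powers of
  \<open>g\<close>.\<close>

lemma Phi_inj:
  assumes "u \<in> F K" "v \<in> F K" "a \<in> F K" "Phi R q w g a j u = Phi R q w g a j v"
  shows "u = v"
proof -
  define A where "A x = w [^] j \<otimes> (x [^] q \<oplus> a \<otimes> x)" for x
  have AF: "A x \<in> F K" if "x \<in> F K" for x
    unfolding A_def using that assms(3) by (rule Phi_coeff_in)
  have "x \<oplus> A x \<otimes> g \<oplus> \<zero> \<otimes> (g \<otimes> g) = Phi R q w g a j x" if "x \<in> F K" for x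
    using AF[OF that] that g_carrier subfld_carrier by (simp add: Phi_def A_def)
  then have "u \<oplus> A u \<otimes> g \<oplus> \<zero> \<otimes> (g \<otimes> g) = v \<oplus> A v \<otimes> g \<oplus> \<zero> \<otimes> (g \<otimes> g)"
    using assms by simp
  then show ?thesis
    using quadratic_coeffs_unique[of u "A u" \<zero> v "A v" \<zero>] AF assms by simp
qed

lemma Phi_zero: "a \<in> carrier R \<Longrightarrow> Phi R q w g a j \<zero> = \<zero>"
  using q_ge_2 g_carrier w_carrier by (simp add: Phi_def nat_pow_zero)

lemma Phi_nonzero:
  assumes "u \<in> F K" "a \<in> F K" "u \<noteq> \<zero>"
  shows "Phi R q w g a j u \<noteq> \<zero>"
  using Phi_inj[of u \<zero> a j] Phi_zero[of a j] subfld_carrier[of a K] assms by auto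

definition block :: "'a \<Rightarrow> 'a \<Rightarrow> nat \<Rightarrow> 'a set \<Rightarrow> 'a set" where
  "block \<beta> a j U = (\<lambda>x. \<beta> \<otimes> x) ` (Phi R q w g a j ` U)"

text \<open>The scalar passes through \<open>Phi\<close> and is absorbed by \<open>U\<close>. By
  \<open>block_eq_imp\<close> this is the only redundancy of the parametrisation.\<close>

lemma block_scale:
  assumes U: "fq_space K k U" and c: "c \<in> F 1" "c \<noteq> \<zero>" and b: "\<beta> \<in> carrier R" "a \<in> F K"
  shows "block (c \<otimes> \<beta>) a j U = block \<beta> a j U"
proof -
  have ac: "a \<in> carrier R" "c \<in> carrier R"
    using b c subfld_carrier by auto
  have UR: "U \<subseteq> carrier R"
    using U subfld_carrier unfolding fq_space_def by blast
  have "block \<beta> a j U = block \<beta> a j ((\<lambda>x. c \<otimes> x) ` U)"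
    using fq_space_scale[OF U c] by simp
  also have "\<dots> = block (c \<otimes> \<beta>) a j U"
    unfolding block_def image_image
  proof (intro image_cong refl)
    fix x assume "x \<in> U"
    then have x: "x \<in> carrier R"
      using UR by blast
    show "\<beta> \<otimes> Phi R q w g a j (c \<otimes> x) = c \<otimes> \<beta> \<otimes> Phi R q w g a j x"
      using Phi_scale[OF c(1) x ac(1)] Phi_carrier[OF x ac(1)] ac b by (simp add: m_ac)
  qed
  finally show ?thesis ..
qed

text \<open>\<open>Phi\<close> is linear over \<open>F 1\<close> and injective on
  \<open>F K\<close>, and so is its product with a nonzero scalar; this carries the invariant to the
  next stage.\<close>

lemma block_fq_space:
  assumes U: "fq_space K k U" and b: "\<beta> \<in> F (3 * K)" "\<beta> \<noteq> \<zero>" and a: "a \<in> F K"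
  shows "fq_space (3 * K) k (block \<beta> a j U)"
  unfolding fq_space_def
proof (intro conjI ballI)
  have UF: "x \<in> F K" if "x \<in> U" for x
    using U that by (auto simp: fq_space_def)
  have UR: "x \<in> carrier R" if "x \<in> U" for x
    using UF[OF that] by (rule subfld_carrier)
  have ac: "a \<in> carrier R" "\<beta> \<in> carrier R"
    using a b subfld_carrier by auto
  have P: "Phi R q w g a j x \<in> carrier R" if "x \<in> U" for x
    using UR[OF that] ac(1) by (rule Phi_carrier)
  show "block \<beta> a j U \<subseteq> F (3 * K)"
    unfolding block_def using UF a b by (auto intro!: subfld_mult Phi_in)
  have "inj_on (\<lambda>x. \<beta> \<otimes> Phi R q w g a j x) U"
  proof (rule inj_onI)
    fix x y assume xy: "x \<in> U" "y \<in> U" "\<beta> \<otimes> Phi R q w g a j x = \<beta> \<otimes> Phi R q w g a j y"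
    then have "Phi R q w g a j x = Phi R q w g a j y"
      using m_lcancel[OF b(2) ac(2) P P] by blast
    then show "x = y"
      using Phi_inj xy UF a by blast
  qed
  then show "card (block \<beta> a j U) = q ^ k"
    using U unfolding block_def image_image by (simp add: card_image fq_space_def)
  show "x \<oplus> y \<in> block \<beta> a j U" if xy: "x \<in> block \<beta> a j U" "y \<in> block \<beta> a j U" for x y
  proof -
    obtain u v where uv: "u \<in> U" "v \<in> U" "x = \<beta> \<otimes> Phi R q w g a j u" "y = \<beta> \<otimes> Phi R q w g a j v"
      using xy by (auto simp: block_def)
    then have "x \<oplus> y = \<beta> \<otimes> Phi R q w g a j (u \<oplus> v)"
      using ac P by (simp add: Phi_add UR r_distr)
    moreover have "u \<oplus> v \<in> U"
      using U uv by (simp add: fq_space_def)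
    ultimately show ?thesis
      unfolding block_def by blast
  qed
  show "c \<otimes> x \<in> block \<beta> a j U" if c: "c \<in> F 1" and x: "x \<in> block \<beta> a j U" for c x
  proof -
    obtain u where u: "u \<in> U" "x = \<beta> \<otimes> Phi R q w g a j u"
      using x by (auto simp: block_def)
    then have "c \<otimes> x = \<beta> \<otimes> Phi R q w g a j (c \<otimes> u)"
      using ac P subfld_carrier[OF c] by (simp add: Phi_scale[OF c] UR m_ac)
    moreover have "c \<otimes> u \<in> U"
      using U u c by (simp add: fq_space_def)
    ultimately show ?thesis
      unfolding block_def by blast
  qed
qed

lemma block_eq_imp:
  assumes U: "fq_space K k U" and V: "fq_space K k V" and k: "k \<ge> 2"
    and b: "\<beta> \<in> carrier R" "\<beta> \<noteq> \<zero>" "\<beta>' \<in> carrier R" "\<beta>' \<noteq> \<zero>"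
    and a: "a \<in> F K" "a' \<in> F K" and j: "j \<le> q - 2" "j' \<le> q - 2"
    and eq: "block \<beta> a j U = block \<beta>' a' j' V"
  shows "a' = a \<and> j' = j \<and> V = U \<and> (\<exists>c \<in> F 1 - {\<zero>}. \<beta>' = c \<otimes> \<beta>)"
proof -
  have UF: "x \<in> F K" if "x \<in> U" for x
    using U that by (auto simp: fq_space_def)
  have VF: "x \<in> F K" if "x \<in> V" for x
    using V that by (auto simp: fq_space_def)
  have ac: "a \<in> carrier R" "a' \<in> carrier R"
    using a subfld_carrier by auto
  have PU: "Phi R q w g a j x \<in> carrier R" if "x \<in> U" for x
    using UF[OF that] subfld_carrier ac by (intro Phi_carrier) auto
  have PV: "Phi R q w g a' j' x \<in> carrier R" if "x \<in> V" for x
    using VF[OF that] subfld_carrier ac by (intro Phi_carrier) auto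
  obtain v1 v2 where v: "v1 \<in> V" "v2 \<in> V" "v1 \<noteq> \<zero>" "v1 \<otimes> v2 [^] q \<noteq> v2 \<otimes> v1 [^] q"
    using fq_space_indep_pair[OF V k] by blast
  have "\<exists>u\<in>U. \<beta> \<otimes> Phi R q w g a j u = \<beta>' \<otimes> Phi R q w g a' j' x" if "x \<in> V" for x
  proof -
    have "\<beta>' \<otimes> Phi R q w g a' j' x \<in> block \<beta> a j U"
      unfolding eq using that by (auto simp: block_def)
    then show ?thesis
      by (auto simp: block_def)
  qed
  then obtain u1 u2 where u: "u1 \<in> U" "u2 \<in> U"
    and e1: "\<beta> \<otimes> Phi R q w g a j u1 = \<beta>' \<otimes> Phi R q w g a' j' v1"
    and e2: "\<beta> \<otimes> Phi R q w g a j u2 = \<beta>' \<otimes> Phi R q w g a' j' v2"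
    using v by metis
  \<comment> \<open>Multiplying \<open>e1\<close> and \<open>e2\<close> crosswise puts the same
    product of scalars on both sides, where it cancels.\<close>
  have "(\<beta> \<otimes> \<beta>') \<otimes> (Phi R q w g a' j' v1 \<otimes> Phi R q w g a j u2) =
      (\<beta>' \<otimes> Phi R q w g a' j' v1) \<otimes> (\<beta> \<otimes> Phi R q w g a j u2)"
    using b PU PV u v by (simp add: m_ac)
  also have "\<dots> = (\<beta> \<otimes> Phi R q w g a j u1) \<otimes> (\<beta>' \<otimes> Phi R q w g a' j' v2)"
    by (simp only: e1 e2)
  also have "\<dots> = (\<beta> \<otimes> \<beta>') \<otimes> (Phi R q w g a j u1 \<otimes> Phi R q w g a' j' v2)"
    using b PU PV u v by (simp add: m_ac)
  finally have cross: "Phi R q w g a' j' v1 \<otimes> Phi R q w g a j u2 = Phi R q w g a j u1 \<otimes> Phi R q w g a' j' v2"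
    using b PU PV u v m_lcancel[of "\<beta> \<otimes> \<beta>'"] by (simp add: integral_iff)
  have u1: "u1 \<noteq> \<zero>"
  proof
    assume "u1 = \<zero>"
    then have "\<beta>' \<otimes> Phi R q w g a' j' v1 = \<zero>"
      using e1 b Phi_zero[OF ac(1)] by simp
    then show False
      using Phi_nonzero[OF VF[OF v(1)] a(2) v(3)] PV[OF v(1)] b by (simp add: integral_iff)
  qed
  \<comment> \<open>The vectors of \<open>V\<close> take the first role because their independence
    is the known one; hence \<open>c\<close> is the ratio of \<open>u1\<close> to
    \<open>v1\<close>.\<close>
  obtain c where c: "a' = a" "j' = j" "c \<in> F 1" "c \<noteq> \<zero>" "u1 = c \<otimes> v1"
    using Phi_collision[OF VF[OF v(1)] VF[OF v(2)] UF[OF u(1)] UF[OF u(2)] a(2,1) j(2,1) v(3) u1 v(4) cross]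
    by blast
  have cc: "c \<in> carrier R"
    using c(3) by (rule subfld_carrier)
  have v1c: "v1 \<in> carrier R"
    using VF[OF v(1)] by (rule subfld_carrier)
  have "\<beta>' \<otimes> Phi R q w g a j v1 = (c \<otimes> \<beta>) \<otimes> Phi R q w g a j v1"
    using e1 Phi_scale[OF c(3) v1c ac(1)] PV[OF v(1)] b cc unfolding c(1,2,5) by (simp add: m_ac)
  then have bc: "\<beta>' = c \<otimes> \<beta>"
    using m_rcancel[OF Phi_nonzero[OF VF[OF v(1)] a(2) v(3)] PV[OF v(1)]] b cc c(1,2) by simp
  have "block \<beta> a j U = block \<beta> a j V"
    \<comment> \<open>Absorbing \<open>c\<close> makes both sides images under one and the same map,
      whose injectivity gives U = V.\<close>
    using eq block_scale[OF V c(3,4) b(1) a(1)] unfolding bc c(1,2) by simp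
  then have im: "(\<lambda>x. \<beta> \<otimes> Phi R q w g a j x) ` U = (\<lambda>x. \<beta> \<otimes> Phi R q w g a j x) ` V"
    by (simp add: block_def image_image)
  have "inj_on (\<lambda>x. \<beta> \<otimes> Phi R q w g a j x) (F K)"
  proof (rule inj_onI)
    fix x y assume xy: "x \<in> F K" "y \<in> F K" "\<beta> \<otimes> Phi R q w g a j x = \<beta> \<otimes> Phi R q w g a j y"
    then have "Phi R q w g a j x = Phi R q w g a j y"
      using m_lcancel[OF b(2,1) Phi_carrier Phi_carrier] ac subfld_carrier by blast
    then show "x = y"
      using Phi_inj xy a by blast
  qed
  then have "U = V"
    using im UF VF by (subst (asm) inj_on_image_eq_iff) auto
  with c bc show ?thesis
    by blast
qed

text \<open>Each codeword arises from exactly q - 1 parameter tuples, one for each nonzero scalar of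
  \<open>F 1\<close>. This cancels the q - 1 choices of the exponent \<open>j\<close>.\<close>

lemma card_blocks:
  assumes fin: "finite \<D>" and sp: "\<And>U. U \<in> \<D> \<Longrightarrow> fq_space K k U" and k: "k \<ge> 2"
  shows "card {block \<beta> a j U | \<beta> a j U. \<beta> \<in> F (3 * K) - {\<zero>} \<and> a \<in> F K \<and> j \<le> q - 2 \<and> U \<in> \<D>} =
    (q ^ (3 * K) - 1) * q ^ K * card \<D>"
proof -
  define S where "S = (F (3 * K) - {\<zero>}) \<times> F K \<times> {..q - 2} \<times> \<D>"
  define f where "f = (\<lambda>(\<beta>, a, j, U). block \<beta> a j U)"
  have finS: "finite S"
    using fin by (simp add: S_def)
  have fibre: "card {t \<in> S. f t = f s} = q - 1" if s: "s \<in> S" for s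
  proof -
    obtain \<beta> a j U where s_eq: "s = (\<beta>, a, j, U)"
      by (metis prod_cases4)
    have b: "\<beta> \<in> F (3 * K)" "\<beta> \<noteq> \<zero>" and a: "a \<in> F K" and j: "j \<le> q - 2" and U: "U \<in> \<D>"
      using s by (auto simp: S_def s_eq)
    have bc: "\<beta> \<in> carrier R"
      using b(1) by (rule subfld_carrier)
    have "{t \<in> S. f t = f s} = (\<lambda>c. (c \<otimes> \<beta>, a, j, U)) ` (F 1 - {\<zero>})"
    proof (intro equalityI subsetI)
      fix t assume t: "t \<in> {t \<in> S. f t = f s}"
      obtain \<beta>' a' j' V where t_eq: "t = (\<beta>', a', j', V)"
        by (metis prod_cases4)
      have b': "\<beta>' \<in> F (3 * K)" "\<beta>' \<noteq> \<zero>" and a': "a' \<in> F K" and j': "j' \<le> q - 2" and V: "V \<in> \<D>"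
        using t by (auto simp: S_def t_eq)
      have "block \<beta> a j U = block \<beta>' a' j' V"
        using t by (simp add: f_def s_eq t_eq)
      from block_eq_imp[OF sp[OF U] sp[OF V] k bc b(2) subfld_carrier[OF b'(1)] b'(2) a a' j j' this]
      show "t \<in> (\<lambda>c. (c \<otimes> \<beta>, a, j, U)) ` (F 1 - {\<zero>})"
        by (auto simp: t_eq)
    next
      fix t assume "t \<in> (\<lambda>c. (c \<otimes> \<beta>, a, j, U)) ` (F 1 - {\<zero>})"
      then obtain c where c: "c \<in> F 1" "c \<noteq> \<zero>" "t = (c \<otimes> \<beta>, a, j, U)"
        by blast
      have "c \<otimes> \<beta> \<in> F (3 * K) - {\<zero>}"
        using subfld_mult[OF subfld_1[OF c(1)] b(1)] integral[OF _ subfld_carrier[OF c(1)] bc] b(2) c(2) by blast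
      then show "t \<in> {t \<in> S. f t = f s}"
        using block_scale[OF sp[OF U] c(1,2) bc a] a j U by (simp add: S_def c(3) f_def s_eq)
    qed
    moreover have "inj_on (\<lambda>c. (c \<otimes> \<beta>, a, j, U)) (F 1 - {\<zero>})"
      using m_rcancel[OF b(2) bc] subfld_carrier by (intro inj_onI) blast
    ultimately show ?thesis
      using card_subfld_1 by (simp add: card_image)
  qed
  have "card S = (\<Sum>y \<in> f ` S. card {t \<in> S. f t = y})"
    using sum.image_gen[OF finS, of "\<lambda>_. 1::nat" f] by simp
  also have "\<dots> = (\<Sum>y \<in> f ` S. q - 1)"
    using fibre by (intro sum.cong) auto
  finally have "card S = (q - 1) * card (f ` S)"
    by simp
  moreover have "card S = (q - 1) * ((q ^ (3 * K) - 1) * q ^ K * card \<D>)"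
    using q_ge_2 card_subfld[OF dvd_n] card_subfld[OF K_dvd]
    by (simp add: S_def card_cartesian_product Suc_diff_Suc numeral_2_eq_2)
  moreover have "f ` S = {block \<beta> a j U | \<beta> a j U. \<beta> \<in> F (3 * K) - {\<zero>} \<and> a \<in> F K \<and> j \<le> q - 2 \<and> U \<in> \<D>}"
    unfolding f_def S_def by (auto simp: image_iff)
  ultimately show ?thesis
    using q_ge_2 by simp
qed

end

subsection \<open>Size of the code and the Johnson bound\<close>

text \<open>Spaces of stage \<open>i\<close> lie in the field of degree 3^i k over
  \<open>F 1\<close>, the base of the next cubic layer. Carrying the subspace property through the
  induction makes \<open>card_blocks\<close> applicable there.\<close>

lemma (in finite_field_order) Dcode_structure:
  assumes n_eq: "n = 3 ^ e * k" and k: "k \<ge> 2"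
    and params: "\<And>i. i \<in> {1..e} \<Longrightarrow> primitive_elem R q (Kidx k i) (w i) \<and> g i \<in> F (3 * Kidx k i) \<and>
        generate_field R (insert (g i) (F (Kidx k i))) = F (3 * Kidx k i)"
    and "i \<le> e"
  shows "finite (Dcode R q k w g i) \<and> (\<forall>U \<in> Dcode R q k w g i. fq_space (3 ^ i * k) k U) \<and>
    card (Dcode R q k w g i) = (\<Prod>l<i. (q ^ (3 * (3 ^ l * k)) - 1) * q ^ (3 ^ l * k))"
  using \<open>i \<le> e\<close>
proof (induction i)
  case 0
  have "fq_space k k (F k)"
    using card_subfld[of k] subfld_1[of _ k] n_eq
    by (auto simp: fq_space_def subfld_add intro: subfld_mult)
  then show ?case
    by simp
next
  case (Suc i)
  define \<D> where "\<D> = Dcode R q k w g i"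
  define K where "K = 3 ^ i * k"
  have IH: "finite \<D>" "\<And>U. U \<in> \<D> \<Longrightarrow> fq_space K k U"
    "card \<D> = (\<Prod>l<i. (q ^ (3 * (3 ^ l * k)) - 1) * q ^ (3 ^ l * k))"
    using Suc by (auto simp: \<D>_def K_def)
  have KK: "Kidx k (Suc i) = K"
    by (simp add: Kidx_def K_def)
  have "3 * K dvd n"
  proof -
    have "3 ^ Suc i dvd (3 ^ e :: nat)"
      using Suc.prems by (intro le_imp_power_dvd)
    then show ?thesis
      unfolding n_eq K_def by (metis mult.assoc mult_dvd_mono dvd_refl power_Suc)
  qed
  moreover have "K \<ge> 2"
  proof -
    have "1 * 2 \<le> 3 ^ i * k"
      using k by (intro mult_le_mono) simp_all
    then show ?thesis
      by (simp add: K_def)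
  qed
  ultimately interpret cubic_step R q n K "w (Suc i)" "g (Suc i)"
    using params[of "Suc i"] Suc.prems by unfold_locales (auto simp: KK)
  have D_Suc: "Dcode R q k w g (Suc i) =
      {block \<beta> a j U | \<beta> a j U. \<beta> \<in> F (3 * K) - {\<zero>} \<and> a \<in> F K \<and> j \<le> q - 2 \<and> U \<in> \<D>}"
    by (simp add: KK block_def \<D>_def)
  have "finite (Dcode R q k w g (Suc i))"
  proof (rule finite_subset)
    show "Dcode R q k w g (Suc i) \<subseteq> Pow (F (3 * K))"
      unfolding D_Suc using block_fq_space IH(2) by (fastforce simp: fq_space_def)
  qed simp
  moreover have "fq_space (3 ^ Suc i * k) k U" if "U \<in> Dcode R q k w g (Suc i)" for U
    using that block_fq_space IH(2) unfolding D_Suc by (auto simp: K_def mult.assoc)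
  moreover have "card (Dcode R q k w g (Suc i)) =
      (\<Prod>l<Suc i. (q ^ (3 * (3 ^ l * k)) - 1) * q ^ (3 ^ l * k))"
    unfolding D_Suc using card_blocks[OF IH(1,2) k] IH(3) by (simp add: K_def mult_ac)
  ultimately show ?case
    by blast
qed

lemma card_Dcode:
  assumes "cyc_setup R q e k w g" "primepow q" "k \<ge> 2"
  shows "card (Dcode R q k w g e) = (\<Prod>l<e. (q ^ (3 * (3 ^ l * k)) - 1) * q ^ (3 ^ l * k))"
proof -
  interpret field R
    using assms(1) by (simp add: cyc_setup_def)
  interpret finite_field_order R q "3 ^ e * k"
    using assms by unfold_locales (simp_all add: cyc_setup_def)
  show ?thesis
    using Dcode_structure[of e k w g e] assms by (auto simp: cyc_setup_def)
qed

section \<open>Numerical estimates\<close>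

text \<open>The exponents form the geometric sum 4k(1 + 3 + ... + 3^(e-1)) = 2k(3^e - 1).\<close>

lemma prod_quartic_power:
  "(\<Prod>l<e. q ^ (4 * (3 ^ l * k))) = (q::nat) ^ (2 * (3 ^ e * k - k))"
proof (induction e)
  case (Suc e)
  have "k \<le> 3 ^ e * k"
    by simp
  moreover have "3 ^ Suc e * k = 3 * (3 ^ e * k)"
    by simp
  ultimately have "2 * (3 ^ e * k - k) + 4 * (3 ^ e * k) = 2 * (3 ^ Suc e * k - k)"
    by linarith
  with Suc show ?case
    by (simp only: prod.lessThan_Suc power_add[symmetric])
qed simp

text \<open>Dropping each subtracted 1 turns the product into \<open>Q\<close>. A factor loses only
  1/q^(3m) in proportion, with m at least k; the weaker error 1/q^(k-1) is used so that it matches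
  the one for the Johnson bound.\<close>

lemma card_product_bounds:
  fixes q k e :: nat
  assumes q: "q \<ge> 2" and k: "k \<ge> 2"
  defines "P \<equiv> \<Prod>l<e. (q ^ (3 * (3 ^ l * k)) - 1) * q ^ (3 ^ l * k)"
    and "Q \<equiv> q ^ (2 * (3 ^ e * k - k))"
  shows "P \<le> Q" and "(1 - 1 / real q ^ (k - 1)) ^ e * real Q \<le> real P"
proof -
  have fac: "q ^ (4 * m) = q ^ (3 * m) * q ^ m" for m
    by (simp add: power_add[symmetric])
  show "P \<le> Q"
    unfolding P_def Q_def prod_quartic_power[symmetric] fac by (intro prod_mono) simp
  define s where "s = real q ^ (k - 1)"
  have s: "s \<ge> 1"
    unfolding s_def using q by (intro one_le_power) simp
  have step: "(1 - 1 / s) * real (q ^ (4 * (3 ^ l * k))) \<le> real ((q ^ (3 * (3 ^ l * k)) - 1) * q ^ (3 ^ l * k))"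
    for l
  proof -
    define m where "m = 3 ^ l * k"
    have "k \<le> m"
      by (simp add: m_def)
    then have "s \<le> real q ^ (3 * m)"
      unfolding s_def using q by (intro power_increasing) auto
    then have "(1 - 1 / s) * real q ^ (3 * m) \<le> real q ^ (3 * m) - 1"
      using s by (simp add: field_simps)
    then have "(1 - 1 / s) * real q ^ (3 * m) * real q ^ m \<le> (real q ^ (3 * m) - 1) * real q ^ m"
      by (intro mult_right_mono) simp_all
    then show ?thesis
      using q unfolding m_def[symmetric] fac by (simp add: of_nat_diff mult.assoc)
  qed
  have "(1 - 1 / s) ^ e * real Q = (\<Prod>l<e. (1 - 1 / s) * real (q ^ (4 * (3 ^ l * k))))"
    by (simp add: Q_def prod_quartic_power[symmetric] prod.distrib)
  also have "\<dots> \<le> (\<Prod>l<e. real ((q ^ (3 * (3 ^ l * k)) - 1) * q ^ (3 ^ l * k)))"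
    using s step by (intro prod_mono) simp
  finally show "(1 - 1 / real q ^ (k - 1)) ^ e * real Q \<le> real P"
    by (simp add: P_def s_def)
qed

lemma Jbound_bounds:
  fixes q k n :: nat
  assumes q: "q \<ge> 2" and k: "k \<ge> 2" and n: "n \<ge> k"
  defines "Q \<equiv> q ^ (2 * (n - k))"
  shows "Q \<le> Jbound q n k" and "(1 - 1 / real q ^ (k - 1)) ^ 2 * real (Jbound q n k) \<le> real Q"
proof -
  define m where "m = (q ^ (n - 1) - 1) div (q ^ (k - 1) - 1)"
  define J where "J = Jbound q n k"
  have J: "J = ((q ^ n - 1) * m) div (q ^ k - 1)"
    by (simp add: J_def Jbound_def m_def)
  have big: "q ^ (k - 1) > 1" "q ^ k > 1"
    using q k by (intro one_less_power; simp)+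
  \<comment> \<open>The sides differ by q^(n-k) - 1. The case b = k - 1 serves the inner floor and b
    = k the outer one.\<close>
  have quot: "q ^ (n - k) * (q ^ b - 1) \<le> q ^ (n - k + b) - 1" for b
    using q by (simp add: power_add diff_mult_distrib2 diff_le_mono2)
  have exps: "n - k + k = n" "n - k + (k - 1) = n - 1"
    using n k by simp_all
  have m_ge: "q ^ (n - k) \<le> m"
    unfolding m_def using quot[of "k - 1"] big exps by (simp add: less_eq_div_iff_mult_less_eq)
  have "Q * (q ^ k - 1) = q ^ (n - k) * (q ^ k - 1) * q ^ (n - k)"
    by (simp add: Q_def mult_2 power_add)
  also have "\<dots> \<le> (q ^ n - 1) * m"
    using quot[of k] m_ge exps by (intro mult_le_mono) simp_all
  finally have "Q \<le> J"
    unfolding J using big by (simp add: less_eq_div_iff_mult_less_eq)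
  then show "Q \<le> Jbound q n k"
    by (simp add: J_def)
  \<comment> \<open>From above, the numerators lose their subtracted 1 and the floors are removed;
    only the denominators contribute an error.\<close>
  have up_m: "m * (q ^ (k - 1) - 1) \<le> q ^ (n - 1)"
    unfolding m_def by (rule order.trans[OF div_times_less_eq_dividend]) simp
  have up_J: "J * (q ^ k - 1) \<le> q ^ n * m"
    unfolding J by (rule order.trans[OF div_times_less_eq_dividend]) simp
  have "J * (q ^ k - 1) * (q ^ (k - 1) - 1) \<le> q ^ n * m * (q ^ (k - 1) - 1)"
    by (rule mult_le_mono1[OF up_J])
  also have "\<dots> = q ^ n * (m * (q ^ (k - 1) - 1))"
    by (rule mult.assoc)
  also have "\<dots> \<le> q ^ n * q ^ (n - 1)"
    by (rule mult_le_mono2[OF up_m])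
  also have "\<dots> = Q * q ^ k * q ^ (k - 1)"
  proof -
    have "n + (n - 1) = 2 * (n - k) + k + (k - 1)"
      using n k by simp
    then show ?thesis
      by (simp only: Q_def power_add[symmetric])
  qed
  finally have "real (J * (q ^ k - 1) * (q ^ (k - 1) - 1)) \<le> real (Q * q ^ k * q ^ (k - 1))"
    by (simp only: of_nat_le_iff)
  then have up: "real J * (real q ^ k - 1) * (real q ^ (k - 1) - 1) \<le> real Q * real q ^ k * real q ^ (k - 1)"
    using q by (simp add: of_nat_diff)
  define s where "s = real q ^ (k - 1)"
  define t where "t = real q ^ k"
  \<comment> \<open>From \<open>s \<le> t\<close> it follows that t - 1 is at least (1 - 1/s) t, so
    both denominators cost the same factor.\<close>
  have st: "1 \<le> s" "s \<le> t"
    unfolding s_def t_def using q by (auto intro: one_le_power power_increasing)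
  then have "(1 - 1 / s) * t \<le> t - 1" "(1 - 1 / s) * s = s - 1" "0 \<le> 1 - 1 / s"
    by (simp_all add: field_simps)
  then have "real J * ((1 - 1 / s) * t) * ((1 - 1 / s) * s) \<le> real J * (t - 1) * (s - 1)"
    using st by (intro mult_mono) auto
  also have "\<dots> \<le> real Q * t * s"
    using up by (simp add: s_def t_def)
  finally have "((1 - 1 / s)\<^sup>2 * real J) * (t * s) \<le> real Q * (t * s)"
    by (simp add: power2_eq_square mult_ac)
  then have "(1 - 1 / s)\<^sup>2 * real J \<le> real Q"
    using st by (simp add: mult_le_cancel_right)
  then show "(1 - 1 / real q ^ (k - 1)) ^ 2 * real (Jbound q n k) \<le> real Q"
    by (simp add: s_def J_def)
qed

text \<open>\<open>Q\<close> mediates between code and bound: the stages contribute e error factors,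
  the two quotients in the Johnson bound two more.\<close>

lemma code_ratio_bounds:
  assumes params: "cyc_setup R q e k w g" and q: "primepow q" and k: "k \<ge> 2"
  defines "r \<equiv> real (card (Dcode R q k w g e)) / real (Jbound q (3 ^ e * k) k)"
  shows "(1 - 1 / real q ^ (k - 1)) ^ (e + 2) \<le> r" and "r \<le> 1"
proof -
  define P where "P = card (Dcode R q k w g e)"
  define J where "J = Jbound q (3 ^ e * k) k"
  define Q where "Q = q ^ (2 * (3 ^ e * k - k))"
  define x where "x = 1 - 1 / real q ^ (k - 1)"
  have q2: "q \<ge> 2"
    using primepow_gt_Suc_0[OF q] by simp
  have P: "P \<le> Q" "x ^ e * real Q \<le> real P"
    using card_product_bounds[OF q2 k, of e] card_Dcode[OF params q k] by (simp_all add: P_def Q_def x_def)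
  have J: "Q \<le> J" "x\<^sup>2 * real J \<le> real Q"
    using Jbound_bounds[OF q2 k, of "3 ^ e * k"] by (simp_all add: J_def Q_def x_def)
  have "Q > 0"
    using q2 by (simp add: Q_def)
  then have J0: "real J > 0"
    using J(1) by simp
  have "1 / s \<le> 1" if "s \<ge> 1" for s :: real
    using that by simp
  then have x0: "x \<ge> 0"
    using one_le_power[of "real q" "k - 1"] q2 unfolding x_def by simp
  have "x ^ (e + 2) * real J = x ^ e * (x\<^sup>2 * real J)"
    by (simp only: power_add mult.assoc)
  also have "\<dots> \<le> x ^ e * real Q"
    using J(2) x0 by (intro mult_left_mono) simp_all
  also have "\<dots> \<le> real P"
    by (rule P(2))
  finally show "(1 - 1 / real q ^ (k - 1)) ^ (e + 2) \<le> r"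
    using J0 unfolding r_def x_def[symmetric] P_def[symmetric] J_def[symmetric] by (simp only: pos_le_divide_eq)
  show "r \<le> 1"
    using J0 P(1) J(1) unfolding r_def P_def[symmetric] J_def[symmetric] by simp
qed

section \<open>The two limits\<close>

text \<open>Keeping the filter and the divergent quantity general lets one squeeze argument serve
  both limits.\<close>

lemma ratio_tendsto_1:
  fixes r s :: "'x \<Rightarrow> real"
  assumes s: "filterlim s at_top F"
    and lower: "eventually (\<lambda>x. (1 - 1 / s x) ^ d \<le> r x) F" and upper: "eventually (\<lambda>x. r x \<le> 1) F"
  shows "(r \<longlongrightarrow> 1) F"
proof (rule tendsto_sandwich[OF lower upper _ tendsto_const])
  have "((\<lambda>x. (1 - inverse (s x)) ^ d) \<longlongrightarrow> (1 - 0) ^ d) F"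
    by (intro tendsto_intros tendsto_inverse_0_at_top s)
  then show "((\<lambda>x. (1 - 1 / s x) ^ d) \<longlongrightarrow> 1) F"
    by (simp add: inverse_eq_divide)
qed

text \<open>In either variable q^(k-1) diverges while the exponent e + 2 stays fixed, so the bounds
  of \<open>code_ratio_bounds\<close> close up at 1.\<close>

theorem theorem4p6:
  fixes e :: nat
  assumes "e \<ge> 2"
  shows "(\<forall>q (R :: nat \<Rightarrow> 'a ring) (w :: nat \<Rightarrow> nat \<Rightarrow> 'a) (g :: nat \<Rightarrow> nat \<Rightarrow> 'a).
            primepow q \<and> (\<forall>k \<ge> 2. cyc_setup (R k) q e k (w k) (g k)) \<longrightarrow>
            ((\<lambda>k. real (card (Dcode (R k) q k (w k) (g k) e)) / real (Jbound q (3 ^ e * k) k))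
               \<longlongrightarrow> 1) sequentially)
       \<and> (\<forall>k (R :: nat \<Rightarrow> 'a ring) (w :: nat \<Rightarrow> nat \<Rightarrow> 'a) (g :: nat \<Rightarrow> nat \<Rightarrow> 'a).
            k \<ge> 2 \<and> (\<forall>q. primepow q \<longrightarrow> cyc_setup (R q) q e k (w q) (g q)) \<longrightarrow>
            ((\<lambda>q. real (card (Dcode (R q) q k (w q) (g q) e)) / real (Jbound q (3 ^ e * k) k))
               \<longlongrightarrow> 1) (inf at_top (principal {q. primepow q})))"
proof (intro conjI allI impI)
  fix q and R :: "nat \<Rightarrow> 'a ring" and w g :: "nat \<Rightarrow> nat \<Rightarrow> 'a"
  assume "primepow q \<and> (\<forall>k \<ge> 2. cyc_setup (R k) q e k (w k) (g k))"
  then have q: "primepow q" and params: "\<And>k. k \<ge> 2 \<Longrightarrow> cyc_setup (R k) q e k (w k) (g k)"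
    by auto
  have grow: "real (k - 1) \<le> real q ^ (k - 1)" for k
    using power_gt_expt[OF primepow_gt_Suc_0[OF q], of "k - 1"]
    by (metis of_nat_le_iff of_nat_power order_less_imp_le)
  have "filterlim (\<lambda>k. real (k - 1)) at_top sequentially"
    by (rule filterlim_compose[OF filterlim_real_sequentially filterlim_minus_const_nat_at_top])
  then have "filterlim (\<lambda>k. real q ^ (k - 1)) at_top sequentially"
    by (rule filterlim_at_top_mono) (simp only: grow eventually_True)
  then show "((\<lambda>k. real (card (Dcode (R k) q k (w k) (g k) e)) / real (Jbound q (3 ^ e * k) k))
               \<longlongrightarrow> 1) sequentially"
  proof (rule ratio_tendsto_1)
    show "\<forall>\<^sub>F k in sequentially. (1 - 1 / real q ^ (k - 1)) ^ (e + 2) \<le>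
        real (card (Dcode (R k) q k (w k) (g k) e)) / real (Jbound q (3 ^ e * k) k)"
      using code_ratio_bounds(1)[OF params q] by (intro eventually_sequentiallyI[of 2])
    show "\<forall>\<^sub>F k in sequentially.
        real (card (Dcode (R k) q k (w k) (g k) e)) / real (Jbound q (3 ^ e * k) k) \<le> 1"
      using code_ratio_bounds(2)[OF params q] by (intro eventually_sequentiallyI[of 2])
  qed
next
  fix k and R :: "nat \<Rightarrow> 'a ring" and w g :: "nat \<Rightarrow> nat \<Rightarrow> 'a"
  assume "k \<ge> 2 \<and> (\<forall>q. primepow q \<longrightarrow> cyc_setup (R q) q e k (w q) (g q))"
  then have k: "k \<ge> 2" and params: "\<And>q. primepow q \<Longrightarrow> cyc_setup (R q) q e k (w q) (g q)"
    by auto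
  let ?F = "inf at_top (principal {q::nat. primepow q})"
  \<comment> \<open>Growth is shown along all natural numbers and then restricted to prime powers.
    As k is at least 2 the exponent is at least 1; for k = 1 the power would be constant.\<close>
  have "filterlim (\<lambda>q. real q ^ (k - 1)) at_top at_top"
  proof (rule filterlim_at_top_mono[OF filterlim_real_sequentially])
    show "\<forall>\<^sub>F q in sequentially. real q \<le> real q ^ (k - 1)"
      using k by (intro eventually_sequentiallyI[of 1] self_le_power) auto
  qed
  then have "filterlim (\<lambda>q. real q ^ (k - 1)) at_top ?F"
    by (rule filterlim_mono) simp_all
  then show "((\<lambda>q. real (card (Dcode (R q) q k (w q) (g q) e)) / real (Jbound q (3 ^ e * k) k))
               \<longlongrightarrow> 1) ?F"
  proof (rule ratio_tendsto_1)
    show "\<forall>\<^sub>F q in ?F. (1 - 1 / real q ^ (k - 1)) ^ (e + 2) \<le>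
        real (card (Dcode (R q) q k (w q) (g q) e)) / real (Jbound q (3 ^ e * k) k)"
      using code_ratio_bounds(1)[OF params _ k] by (simp add: eventually_inf_principal)
    show "\<forall>\<^sub>F q in ?F.
        real (card (Dcode (R q) q k (w q) (g q) e)) / real (Jbound q (3 ^ e * k) k) \<le> 1"
      using code_ratio_bounds(2)[OF params _ k] by (simp add: eventually_inf_principal)
  qed
qed

end
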